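(* Let $n\ge5$, $0\le\theta\le\pi$, and $x=\theta/(2\pi)$. Then $$K_{n-1}(\theta)\le K_n(\theta).$$ If $x\in F_{n-1}$, both values equal $1$. Otherwise, let $a/b<c/d$ be the consecutive fractions of $F_{n-1}$ (in lowest terms) with $a/b<x<c/d$, and put $q=\min\{b,d\}$. Equality holds precisely when these endpoints remain consecutive in $F_n$ and $$\lfloor(n-1)/q\rfloor=\lfloor n/q\rfloor.$$
   Context: $F_k$ is the increasing list of reduced fractions in $[0,1]$ with denominator at most $k$. For $k\ge4$ and $\theta\in[0,\pi]$ the number $K_k(\theta)$ is defined as follows. Put $x=\theta/(2\pi)\in[0,1/2]$. If $x\in F_k$, set $K_k(\theta)=1$. Otherwise let $f<g$ be the consecutive fractions in $F_k\cap[0,1/2]$ with $f<x<g$, and set $(p/q,r/s,y)=(f,g,x)$ if $f$ has the smaller denominator, and $(p/q,r/s,y)=(1-g,1-f,1-x)$ if $g$ has the smaller denominator (all fractions in lowest terms; so $p/q<y<r/s$, $q<s$, $rq-ps=1$). Put $$m=\lfloor k/q\rfloor,\quad A=2\pi q\left(y-\frac pq\right),\quad B=\frac{2\pi s}{m}\left(\frac rs-y\right);$$ then $A,B>0$ and $A+B<\pi$, and $K_k(\theta)$ is the unique solution $\rho\in(0,1)$ of $\rho^{s/m}\sin A+\rho^q\sin B=\sin(A+B)$. (In the claim, the letter $q$ denotes $\min\{b,d\}$ as specified there.) *)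

theory Defs
  imports Complex_Main
begin

definition den :: "rat \<Rightarrow> nat" where
  "den r = nat (snd (quotient_of r))"

text \<open>The increasing list of Farey fractions is represented by its underlying set; neighbours in the
  list are the pairs related by \<open>consecutive_in\<close>.\<close>

definition farey :: "nat \<Rightarrow> rat set" where
  "farey k = {r. 0 \<le> r \<and> r \<le> 1 \<and> den r \<le> k}"

definition consecutive_in :: "rat set \<Rightarrow> rat \<Rightarrow> rat \<Rightarrow> bool" where
  "consecutive_in S f g \<longleftrightarrow> f \<in> S \<and> g \<in> S \<and> f < g \<and> \<not> (\<exists>h\<in>S. f < h \<and> h < g)"

text \<open>The definition is meant for \<open>k \<ge> 4\<close> and \<open>0 \<le> \<theta> \<le> \<pi>\<close>; then both definite descriptions are
  uniquely satisfied and \<open>den f \<noteq> den g\<close>. Here \<open>u = p/q\<close> and \<open>v = r/s\<close>.\<close>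

definition K :: "nat \<Rightarrow> real \<Rightarrow> real" where
  "K k \<theta> =
    (let x = \<theta> / (2 * pi) in
     if x \<in> real_of_rat ` farey k then 1
     else
       let (f, g) = (THE (f, g). consecutive_in (farey k \<inter> {0..1/2}) f g
                        \<and> real_of_rat f < x \<and> x < real_of_rat g);
           (u, v, y) = (if den f < den g then (f, g, x) else (1 - g, 1 - f, 1 - x));
           q = den u;
           s = den v;
           m = k div q;
           A = 2 * pi * real q * (y - real_of_rat u);
           B = 2 * pi * real s / real m * (real_of_rat v - y)
       in THE \<rho>. 0 < \<rho> \<and> \<rho> < 1 \<and>
            \<rho> powr (real s / real m) * sin A + \<rho> ^ q * sin B = sin (A + B))"

end

theory Submission
  imports Defs
begin

text \<open>Put \<open>T = (cos A - \<rho>^q) / sin A\<close> and \<open>\<phi> t = cos t + T * sin t\<close>. Then \<open>\<phi> 0 = 1\<close> and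
  \<open>\<phi> (- A) = \<rho>^q\<close>, and the equation for \<open>\<rho>\<close> says \<open>\<phi> B = \<rho> powr (s / m)\<close>. As a shifted cosine, \<open>\<phi>\<close> is
  strictly log-concave where it is positive; this is the identity
  \<open>\<phi> (a + b) = \<phi> a * \<phi> b - (1 + T\<^sup>2) * sin a * sin b\<close>. Since the left side of the equation is
  increasing in \<open>\<rho>\<close>, the root grows from \<open>n - 1\<close> to \<open>n\<close> as soon as the old root makes the left side of the
  new equation too small. There are three possible changes: \<open>m\<close> becomes \<open>m + 1\<close>; or
  the mediant of the neighbours \<open>p/q\<close> and \<open>r/s\<close> enters and \<open>y\<close> lies below it, so that \<open>B\<close> and \<open>s\<close> become \<open>B - A / m\<close>
  and \<open>s + q\<close>; or \<open>y\<close> lies above it, so that \<open>A\<close>, \<open>B\<close>, \<open>q\<close>, \<open>s\<close>, \<open>m\<close> become \<open>m * B\<close>,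
  \<open>A - m * B\<close>, \<open>s\<close>, \<open>q + s\<close>, \<open>1\<close>. Log-concavity of \<open>\<phi>\<close> on \<open>[- A, B]\<close> gives the strict inequality each time.\<close>

section \<open>Farey neighbours\<close>

lemma den_pos: "0 < den r"
  by (simp add: den_def quotient_of_denom_pos')

lemma den_mult: "of_nat (den r) * r = of_int (fst (quotient_of r))"
proof -
  have "r = of_int (fst (quotient_of r)) / of_int (snd (quotient_of r))"
    by (rule quotient_of_div) simp
  moreover have "snd (quotient_of r) > 0" by (rule quotient_of_denom_pos')
  ultimately show ?thesis
    by (simp add: den_def field_simps)
qed

text \<open>By coprimality the reduced denominator divides every \<open>n\<close> that clears it.
  This bounds denominators of fractions given in a possibly reducible form.\<close>

lemma den_le:
  assumes "0 < n" and "of_nat n * r = of_int z"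
  shows "den r \<le> n"
proof -
  obtain p d where pd: "quotient_of r = (p, d)" by fastforce
  have d: "d > 0" using quotient_of_denom_pos[OF pd] .
  have r: "r = of_int p / of_int d" using quotient_of_div[OF pd] .
  have "(of_int (int n * p) :: rat) = of_int (z * d)"
    using assms d r by (simp add: field_simps)
  then have eq: "int n * p = z * d" by (simp only: of_int_eq_iff)
  have "coprime d p" using quotient_of_coprime[OF pd] by (simp add: coprime_commute)
  moreover have "d dvd int n * p" using eq by simp
  ultimately have "d dvd int n" by (simp add: coprime_dvd_mult_left_iff)
  then have "d \<le> int n" using assms(1) by (intro zdvd_imp_le) auto
  then show ?thesis using d by (simp add: den_def pd)
qed

lemma den_one_minus [simp]: "den (1 - r) = den r"
proof -
  have le: "den (1 - r) \<le> den r" for r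
    using den_mult[of r]
    by (intro den_le[where z = "int (den r) - fst (quotient_of r)"])
       (simp_all add: den_pos algebra_simps)
  from le[of r] le[of "1 - r"] show ?thesis by simp
qed

text \<open>The product is a determinant of numerators and denominators, hence an integer, and it is
  positive.\<close>

lemma gap_ge:
  assumes "a < b"
  shows "1 \<le> (b - a) * of_nat (den a) * of_nat (den b)"
proof -
  let ?z = "fst (quotient_of b) * int (den a) - fst (quotient_of a) * int (den b)"
  have "(b - a) * of_nat (den a) * of_nat (den b) = of_int ?z"
    by (simp add: den_mult[symmetric] algebra_simps)
  moreover have "0 < (b - a) * of_nat (den a) * of_nat (den b)"
    using assms by (simp add: den_pos)
  ultimately show ?thesis by (simp only: of_int_0_less_iff of_int_1_le_iff)
qed

section \<open>Reflection, finiteness and bracketing\<close>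

lemma one_minus_farey [simp]: "1 - r \<in> farey k \<longleftrightarrow> r \<in> farey k"
  by (auto simp: farey_def)

lemma finite_farey: "finite (farey k)"
proof (rule finite_subset)
  show "farey k \<subseteq> (\<lambda>(a, b). of_int a / of_int b) ` ({0..int k} \<times> {0..int k})"
  proof
    fix r assume r: "r \<in> farey k"
    let ?a = "fst (quotient_of r)"
    have "of_int ?a \<le> (of_nat (den r) :: rat)"
      using r by (simp add: den_mult[symmetric] farey_def mult_left_le)
    then have le: "?a \<le> int (den r)" by (metis of_int_le_iff of_int_of_nat_eq)
    have "(0 :: rat) \<le> of_int ?a"
      using r by (simp add: den_mult[symmetric] farey_def)
    then have ge: "0 \<le> ?a" by simp
    have "r = of_int ?a / of_int (int (den r))"
      using den_pos[of r] by (simp add: den_mult[symmetric])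
    moreover have "(?a, int (den r)) \<in> {0..int k} \<times> {0..int k}"
      using le ge r by (auto simp: farey_def)
    ultimately show "r \<in> (\<lambda>(a, b). of_int a / of_int b) ` ({0..int k} \<times> {0..int k})"
      by (metis (no_types, lifting) case_prod_conv image_iff)
  qed
qed simp

lemma consecutive_in_farey_reflect:
  "consecutive_in (farey k) (1 - g) (1 - f) \<longleftrightarrow> consecutive_in (farey k) f g"
proof -
  have sub: "consecutive_in (farey k) (1 - g) (1 - f)" if "consecutive_in (farey k) f g" for f g
  proof -
    have "\<not> (1 - g < h \<and> h < 1 - f)" if "h \<in> farey k" for h
    proof -
      have "1 - h \<in> farey k" using that by simp
      then have "\<not> (f < 1 - h \<and> 1 - h < g)"
        using \<open>consecutive_in (farey k) f g\<close> by (auto simp: consecutive_in_def)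
      then show ?thesis by linarith
    qed
    then show ?thesis using that by (auto simp: consecutive_in_def)
  qed
  show ?thesis using sub[of f g] sub[of "1 - g" "1 - f"] by auto
qed

lemma consecutive_in_bracket:
  fixes x :: real
  assumes "finite S" and "a \<in> S" and "b \<in> S" and "of_rat a < x" and "x < of_rat b"
    and notin: "x \<notin> of_rat ` S"
  shows "\<exists>f g. consecutive_in S f g \<and> of_rat f < x \<and> x < of_rat g"
proof (intro exI conjI)
  let ?L = "{r \<in> S. of_rat r < x}" and ?R = "{r \<in> S. x < of_rat r}"
  have fin: "finite ?L" "finite ?R" using assms by auto
  have ne: "?L \<noteq> {}" "?R \<noteq> {}" using assms by auto
  have L: "Max ?L \<in> ?L" and R: "Min ?R \<in> ?R"
    using Max_in[OF fin(1) ne(1)] Min_in[OF fin(2) ne(2)] by auto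
  show Lx: "of_rat (Max ?L) < x" and Rx: "x < of_rat (Min ?R)" using L R by auto
  have "of_rat (Max ?L) < (of_rat (Min ?R) :: real)" using Lx Rx by linarith
  then have "Max ?L < Min ?R" by (simp only: of_rat_less)
  moreover have "\<not> (Max ?L < h \<and> h < Min ?R)" if "h \<in> S" for h
  proof -
    have "of_rat h \<noteq> x" using that notin by auto
    then have "h \<in> ?L \<or> h \<in> ?R" using that by auto
    then show ?thesis
      using Max_ge[OF fin(1), of h] Min_le[OF fin(2), of h] by auto
  qed
  ultimately show "consecutive_in S (Max ?L) (Min ?R)"
    using L R by (auto simp: consecutive_in_def)
qed

lemma consecutive_in_unique:
  fixes x :: real
  assumes "consecutive_in S f g" "of_rat f < x" "x < of_rat g"
    and "consecutive_in S f' g'" "of_rat f' < x" "x < of_rat g'"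
  shows "f = f'" "g = g'"
proof -
  have "of_rat f < (of_rat g' :: real)" "of_rat f' < (of_rat g :: real)" using assms by linarith+
  then have "f < g'" "f' < g" by (simp_all only: of_rat_less)
  then show "f = f'" "g = g'"
    using assms(1,4) unfolding consecutive_in_def by (meson linorder_neqE)+
qed

lemma consecutive_in_not_between:
  fixes x :: real
  assumes "consecutive_in S f g" "of_rat f < x" "x < of_rat g"
  shows "x \<notin> of_rat ` S"
  using assms by (auto simp: consecutive_in_def of_rat_less)

section \<open>Unimodularity and mediants\<close>

lemma bezout_window:
  fixes p :: int and d k :: nat
  assumes "0 < d" and "d \<le> k" and "coprime p (int d)"
  shows "\<exists>v>0. v \<le> k \<and> k < d + v \<and> int d dvd int v * p + 1"
proof -
  obtain a b where ab: "a * p + b * int d = 1"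
    using assms(3) by (metis bezout_int coprime_imp_gcd_eq_1)
  \<comment> \<open>Modulo \<open>d\<close> the inverse of \<open>p\<close> is \<open>a\<close>, so
    every \<open>v\<close> congruent to \<open>- a\<close> works. This one is the largest up to
    \<open>k\<close>, and \<open>d \<le> k\<close> keeps it positive.\<close>
  define v where "v = int k - (int k + a) mod int d"
  have m: "0 \<le> (int k + a) mod int d" "(int k + a) mod int d < int d"
    using assms(1) by auto
  have "int d dvd (int k + a) - (int k + a) mod int d" by (rule dvd_minus_mod)
  then have "int d dvd v + a" by (simp add: v_def algebra_simps)
  then have "int d dvd (v + a) * p + b * int d" by (intro dvd_add) auto
  also have "(v + a) * p + b * int d = v * p + 1" using ab by (simp add: algebra_simps)
  finally have "int d dvd v * p + 1" .
  then show ?thesis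
    using m assms(2) by (intro exI[of _ "nat v"]) (auto simp: v_def)
qed

text \<open>By Bezout there is a fraction at distance \<open>1 / (den u * w)\<close> to the right of \<open>u\<close> whose
  denominator \<open>w\<close> lies in the window \<open>(k - den u, k]\<close>; anything strictly between the two has
  denominator at least \<open>den u + w > k\<close>, so this fraction is the right neighbour.\<close>

lemma consecutive_in_farey_unimodular:
  assumes "consecutive_in (farey k) u v"
  shows "(v - u) * of_nat (den u) * of_nat (den v) = 1" and "k < den u + den v"
proof -
  let ?d = "den u" and ?e = "den v" and ?p = "fst (quotient_of u)"
  have uv: "0 \<le> u" "u < v" "v \<le> 1" "?d \<le> k" "?e \<le> k"
    using assms by (auto simp: consecutive_in_def farey_def)
  have "coprime ?p (int ?d)"
    using quotient_of_coprime[of u ?p "snd (quotient_of u)"] quotient_of_denom_pos'[of u]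
    by (simp add: den_def)
  then obtain w where w: "0 < w" "w \<le> k" "k < ?d + w" and dvd: "int ?d dvd int w * ?p + 1"
    using bezout_window[OF den_pos uv(4)] by blast
  from dvd obtain z where z: "int w * ?p + 1 = int ?d * z" by (auto elim: dvdE)
  define h where "h = u + 1 / (of_nat ?d * of_nat w)"
  have pos: "(0::rat) < of_nat ?d" "(0::rat) < of_nat ?e" "(0::rat) < of_nat w"
    using den_pos w by auto
  have "of_int (int w * ?p + 1) = (of_int (int ?d * z) :: rat)" using z by simp
  then have "of_nat w * (of_nat ?d * u) + 1 = of_nat ?d * (of_int z :: rat)"
    by (simp add: den_mult)
  then have "of_nat w * h = of_int z"
    using pos by (simp add: h_def field_simps)
  then have den_h: "den h \<le> w" using den_le w(1) by blast
  have "u < h" using pos by (simp add: h_def)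
  have "v \<le> h"
  proof (rule ccontr)
    assume "\<not> v \<le> h"
    then have "h < v" by simp
    then have "h \<in> farey k" using \<open>u < h\<close> uv den_h w by (auto simp: farey_def)
    then show False using \<open>u < h\<close> \<open>h < v\<close> assms by (auto simp: consecutive_in_def)
  qed
  have "1 \<le> (v - u) * of_nat ?d * of_nat ?e" using gap_ge uv by blast
  then have gap_u: "of_nat w \<le> (v - u) * of_nat ?d * of_nat ?e * of_nat w"
    using pos by simp
  have total: "(h - u) * of_nat ?d * of_nat w = 1" using pos by (simp add: h_def)
  have "h = v"
  proof (rule ccontr)
    assume "h \<noteq> v"
    then have "v < h" using \<open>v \<le> h\<close> by simp
    then have "1 \<le> (h - v) * of_nat ?e * of_nat (den h)" by (rule gap_ge)
    also have "\<dots> \<le> (h - v) * of_nat ?e * of_nat w"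
      using \<open>v < h\<close> pos den_h by (intro mult_left_mono) auto
    finally have "of_nat ?d \<le> (h - v) * of_nat ?e * of_nat w * of_nat ?d"
      using pos by simp
    with gap_u have "of_nat (?d + w) \<le> of_nat ?e * ((h - u) * of_nat ?d * of_nat w)"
      by (simp add: algebra_simps)
    then have "(of_nat (?d + w) :: rat) \<le> of_nat ?e" using total by simp
    then have "?d + w \<le> ?e" by (simp only: of_nat_le_iff)
    then show False using w uv by simp
  qed
  \<comment> \<open>So far \<open>w\<close> might be a proper multiple of the reduced denominator;
    the gap bound excludes this.\<close>
  have "(of_nat w :: rat) \<le> of_nat ?e * ((v - u) * of_nat ?d * of_nat w)"
    using gap_u by (simp add: algebra_simps)
  then have "(of_nat w :: rat) \<le> of_nat ?e" using total \<open>h = v\<close> by simp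
  then have "w = ?e" using den_h \<open>h = v\<close> by simp
  then show "(v - u) * of_nat ?d * of_nat ?e = 1" "k < ?d + ?e"
    using total w \<open>h = v\<close> by simp_all
qed

text \<open>With \<open>?a\<close> and \<open>?b\<close> the determinants of the pairs
  \<open>u\<close>, \<open>h\<close> and \<open>h\<close>, \<open>v\<close>, unimodularity gives
  \<open>den h = ?a * den v + ?b * den u\<close>, and \<open>gap_ge\<close> makes both coefficients
  at least 1. If \<open>den h\<close> is minimal, both are 1, so the two halves are unimodular
  again.\<close>

lemma unimodular_between:
  assumes "(v - u) * of_nat (den u) * of_nat (den v) = 1" and "u < h" and "h < v"
  shows "den u + den v \<le> den h"
    and "den h = den u + den v \<Longrightarrow> (h - u) * of_nat (den u) * of_nat (den h) = 1"
    and "den h = den u + den v \<Longrightarrow> (v - h) * of_nat (den h) * of_nat (den v) = 1"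
proof -
  let ?d = "of_nat (den u) :: rat" and ?e = "of_nat (den v) :: rat" and ?n = "of_nat (den h) :: rat"
  have pos: "0 < ?d" "0 < ?e" using den_pos by auto
  let ?a = "(h - u) * ?d * ?n" and ?b = "(v - h) * ?n * ?e"
  have ab: "1 \<le> ?a" "1 \<le> ?b" using gap_ge assms by blast+
  have "?a * ?e + ?b * ?d = ?n * ((v - u) * ?d * ?e)" by (simp add: algebra_simps)
  then have sum: "?a * ?e + ?b * ?d = ?n" using assms(1) by simp
  have le: "?e \<le> ?a * ?e" "?d \<le> ?b * ?d" using ab pos by simp_all
  with sum have "?d + ?e \<le> ?n" by linarith
  then have "(of_nat (den u + den v) :: rat) \<le> of_nat (den h)" by simp
  then show "den u + den v \<le> den h" by (simp only: of_nat_le_iff)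
  assume "den h = den u + den v"
  then have "?n = ?d + ?e" by simp
  then have "?a * ?e = ?e" "?b * ?d = ?d" using sum le by linarith+
  then show "?a = 1" "?b = 1" using pos by simp_all
qed

lemma unimodular_consecutive:
  assumes "u \<in> farey k" and "v \<in> farey k" and "u < v"
    and "(v - u) * of_nat (den u) * of_nat (den v) = 1" and "k < den u + den v"
  shows "consecutive_in (farey k) u v"
  using assms unimodular_between(1)[OF assms(4)]
  by (force simp: consecutive_in_def farey_def)

text \<open>A fraction separating the pair is new, so its denominator is exactly \<open>n\<close>.
  It is at least \<open>den u + den v\<close> by \<open>unimodular_between\<close>, and at most that
  because the sum exceeds \<open>n - 1\<close>.\<close>

lemma consecutive_in_farey_split:
  assumes uv: "consecutive_in (farey (n - 1)) u v" and not: "\<not> consecutive_in (farey n) u v"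
  obtains w where "consecutive_in (farey n) u w" and "consecutive_in (farey n) w v"
    and "den w = n" and "n = den u + den v"
proof -
  have uni: "(v - u) * of_nat (den u) * of_nat (den v) = 1" "n - 1 < den u + den v"
    using consecutive_in_farey_unimodular[OF uv] by auto
  have mem: "u \<in> farey n" "v \<in> farey n" "u < v"
    using uv by (auto simp: consecutive_in_def farey_def)
  with not obtain w where w: "w \<in> farey n" "u < w" "w < v"
    by (auto simp: consecutive_in_def)
  then have "w \<notin> farey (n - 1)" using uv by (auto simp: consecutive_in_def)
  then have "den w = n" using w(1) by (auto simp: farey_def)
  moreover have "n = den u + den v"
    using unimodular_between(1)[OF uni(1) w(2,3)] uni(2) \<open>den w = n\<close> by linarith
  ultimately have d: "den w = den u + den v" by simp
  show thesis
  proof (rule that)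
    show "consecutive_in (farey n) u w"
      using unimodular_between(2)[OF uni(1) w(2,3) d] mem w \<open>den w = n\<close> den_pos[of u]
      by (intro unimodular_consecutive) auto
    show "consecutive_in (farey n) w v"
      using unimodular_between(3)[OF uni(1) w(2,3) d] mem w \<open>den w = n\<close> den_pos[of v]
      by (intro unimodular_consecutive) auto
  qed fact+
qed

section \<open>Log-concavity of shifted cosines\<close>

text \<open>This is \<phi> of the overview: sqrt (1 + T^2) times a cosine shifted by arctan
  T.\<close>

definition tcos :: "real \<Rightarrow> real \<Rightarrow> real" where
  "tcos T t = cos t + T * sin t"

lemma tcos_0 [simp]: "tcos T 0 = 1"
  by (simp add: tcos_def)

lemma tcos_minus: "tcos T (- t) = tcos (- T) t"
  by (simp add: tcos_def)

lemma tcos_add: "tcos T (a + b) = tcos T a * tcos T b - (1 + T\<^sup>2) * sin a * sin b"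
  by (simp add: tcos_def sin_add cos_add algebra_simps power2_eq_square)

text \<open>Midpoint log-concavity with an explicit deficit.\<close>

lemma tcos_add_diff: "tcos T (t + h) * tcos T (t - h) = (tcos T t)\<^sup>2 - (1 + T\<^sup>2) * (sin h)\<^sup>2"
proof -
  have "(sin t)\<^sup>2 + (cos t)\<^sup>2 = 1" "(sin h)\<^sup>2 + (cos h)\<^sup>2 = 1" by simp_all
  then show ?thesis
    unfolding tcos_def sin_add cos_add sin_diff cos_diff by algebra
qed

text \<open>Interpolation between the value 1 at 0 and the value at \<open>b\<close>. For
  \<open>0 \<le> t \<le> b < pi\<close> both weights are nonnegative, so positivity at
  \<open>b\<close> spreads to the whole interval.\<close>

lemma tcos_interpolate: "tcos T t * sin b = sin (b - t) + tcos T b * sin t"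
  by (simp add: tcos_def sin_diff algebra_simps)

lemma tcos_pos:
  assumes "0 < tcos T b" and "0 < t" and "t \<le> b" and "b < pi"
  shows "0 < tcos T t"
proof -
  have "0 < sin b" "0 < sin t" "0 \<le> sin (b - t)" using assms by (auto intro: sin_gt_zero sin_ge_zero)
  then have "0 < tcos T t * sin b"
    using assms(1) by (subst tcos_interpolate) (simp add: add_nonneg_pos)
  then show ?thesis using \<open>0 < sin b\<close> zero_less_mult_pos2 by blast
qed

text \<open>While the angles stay in [0, pi], the term subtracted in \<open>tcos_add\<close> is
  nonnegative, so \<open>tcos T\<close> is submultiplicative there.\<close>

lemma tcos_mult_le_power:
  assumes "0 \<le> h" and "real j * h \<le> pi" and "0 \<le> tcos T h"
  shows "tcos T (real j * h) \<le> tcos T h ^ j"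
  using assms(2)
proof (induction j)
  case (Suc j)
  show ?case
  proof (cases j)
    case (Suc i)
    have eq: "real (Suc j) * h = real j * h + h" by (simp add: algebra_simps)
    have "0 \<le> real i * h" "real j * h = real i * h + h"
      using assms(1) Suc by (simp_all add: algebra_simps)
    then have j: "0 \<le> real j * h" "real j * h \<le> pi" "h \<le> pi"
      using Suc.prems assms(1) eq by linarith+
    have "tcos T (real (Suc j) * h) = tcos T (real j * h) * tcos T h
        - (1 + T\<^sup>2) * sin (real j * h) * sin h"
      unfolding eq by (rule tcos_add)
    also have "\<dots> \<le> tcos T (real j * h) * tcos T h"
      using j assms(1) by (simp add: sin_ge_zero)
    also have "\<dots> \<le> tcos T h ^ j * tcos T h"
      using Suc.IH j assms(3) by (intro mult_right_mono) auto
    finally show ?thesis by (simp add: mult.commute)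
  qed simp
qed simp

text \<open>A strictly concave function vanishing at 0 has decreasing secant slopes from 0. Applied
  to the logarithm of \<open>tcos T\<close> at two multiples of \<open>h\<close>, this gives the
  claim; integer exponents avoid roots.\<close>

lemma tcos_power_less:
  assumes "0 < h" and "1 \<le> j" and "real (Suc j) * h < pi" and "0 < tcos T (real (Suc j) * h)"
  shows "tcos T (real (Suc j) * h) ^ j < tcos T (real j * h) ^ Suc j"
  using assms(2-4)
proof (induction j rule: dec_induct)
  case base
  have "tcos T (h + h) = (tcos T h)\<^sup>2 - (1 + T\<^sup>2) * (sin h)\<^sup>2"
    unfolding tcos_add by (simp add: power2_eq_square)
  moreover have "0 < (1 + T\<^sup>2) * (sin h)\<^sup>2"
  proof -
    have "0 < sin h" using base assms(1) by (intro sin_gt_zero) auto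
    then show ?thesis by (simp add: add_pos_nonneg)
  qed
  ultimately show ?case by (simp add: power2_eq_square)
next
  case (step j)
  define a where "a i = tcos T (real i * h)" for i
  have le: "real i * h \<le> real (Suc (Suc j)) * h" if "i \<le> Suc (Suc j)" for i
    using that assms(1) by (intro mult_right_mono) auto
  have pos: "0 < a i" if "1 \<le> i" "i \<le> Suc (Suc j)" for i
    unfolding a_def using step.prems le[OF that(2)] assms(1) that(1)
      tcos_pos[of T "real (Suc (Suc j)) * h" "real i * h"] by simp
  have "h \<le> real (Suc (Suc j)) * h" using le[of 1] by simp
  then have "0 < sin h" using step.prems(1) assms(1) by (intro sin_gt_zero) linarith+
  then have "0 < (1 + T\<^sup>2) * (sin h)\<^sup>2" by (simp add: add_pos_nonneg)
  then have conc: "a (Suc (Suc j)) * a j < (a (Suc j))\<^sup>2"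
    using tcos_add_diff[of T "real (Suc j) * h" h] by (simp add: a_def algebra_simps)
  have IH: "a (Suc j) ^ j < a j ^ Suc j"
    unfolding a_def using step.prems le[of "Suc j"] pos[of "Suc j"]
    by (intro step.IH) (auto simp: a_def)
  have p: "0 < a j" "0 < a (Suc j)" "0 < a (Suc (Suc j))" using pos step.hyps by auto
  \<comment> \<open>The induction hypothesis is combined with \<open>conc\<close> raised to the
    power \<open>Suc j\<close>; the factor \<open>a (Suc j) ^ j\<close> then cancels.\<close>
  have "a (Suc (Suc j)) ^ Suc j * a (Suc j) ^ j < a (Suc (Suc j)) ^ Suc j * a j ^ Suc j"
    using IH p by (intro mult_strict_left_mono) auto
  also have "\<dots> = (a (Suc (Suc j)) * a j) ^ Suc j" by (simp add: power_mult_distrib)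
  also have "\<dots> < ((a (Suc j))\<^sup>2) ^ Suc j"
    using conc p by (intro power_strict_mono) auto
  also have "\<dots> = a (Suc j) ^ Suc (Suc j) * a (Suc j) ^ j"
    by (simp add: power2_eq_square power_mult_distrib)
  finally have "a (Suc (Suc j)) ^ Suc j < a (Suc j) ^ Suc (Suc j)"
    using p by (simp only: mult_less_cancel_right_pos zero_less_power)
  then show ?case by (simp only: a_def)
qed

section \<open>The trinomial equation\<close>

text \<open>The left side increases strictly from 0 at 0 to \<open>sin A + sin B\<close> at 1, which
  exceeds \<open>sin (A + B)\<close> because both cosines in the addition formula are below
  1.\<close>

lemma trinomial_root_ex1:
  assumes "0 < A" and "0 < B" and "A + B < pi" and "0 < e" and "0 < q"
  shows "\<exists>!\<rho>::real. 0 < \<rho> \<and> \<rho> < 1 \<and> \<rho> powr e * sin A + \<rho> ^ q * sin B = sin (A + B)"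
proof -
  define F where "F \<rho> = \<rho> powr e * sin A + \<rho> ^ q * sin B" for \<rho> :: real
  have sins: "0 < sin A" "0 < sin B" "0 < sin (A + B)"
    using assms by (auto intro: sin_gt_zero)
  have mono: "F a < F b" if "0 \<le> a" "a < b" for a b
    unfolding F_def using that assms sins
    by (intro add_strict_mono mult_strict_right_mono powr_less_mono2 power_strict_mono) auto
  have "cos A < 1" "cos B < 1"
    using cos_monotone_0_pi[of 0 A] cos_monotone_0_pi[of 0 B] assms by auto
  then have "sin A * cos B < sin A" "cos A * sin B < sin B"
    using sins by (simp_all add: mult_less_cancel_left1)
  then have one: "sin (A + B) < F 1" by (simp add: sin_add F_def)
  have zero: "F 0 < sin (A + B)" using assms sins by (simp add: F_def zero_power)
  have "continuous_on {0..1} F"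
    unfolding F_def using assms by (intro continuous_intros continuous_on_powr') auto
  then obtain \<rho> where \<rho>: "0 \<le> \<rho>" "\<rho> \<le> 1" "F \<rho> = sin (A + B)"
    using IVT'[of F 0 "sin (A + B)" 1] zero one by auto
  then have "0 < \<rho>" "\<rho> < 1" using zero one by (auto simp: less_le)
  then show ?thesis
    using \<rho> mono unfolding F_def[symmetric]
    by (intro ex1I[of _ \<rho>]) (auto, metis less_imp_le linorder_neqE_linordered_idom order_less_irrefl)
qed

text \<open>The new root is never computed: the old one is inserted into the new equation, and
  monotonicity decides.\<close>

lemma trinomial_root_greater:
  assumes "0 < A" and "0 < B" and "A + B < pi" and "0 < e" and "0 < \<sigma>"
    and "\<sigma> powr e * sin A + \<sigma> ^ q * sin B = sin (A + B)"
    and "0 < \<rho>" and "\<rho> powr e * sin A + \<rho> ^ q * sin B < sin (A + B)"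
  shows "\<rho> < \<sigma>"
proof (rule ccontr)
  assume "\<not> \<rho> < \<sigma>"
  moreover have "0 < sin A" "0 < sin B" using assms by (auto intro: sin_gt_zero)
  ultimately have "\<sigma> powr e * sin A + \<sigma> ^ q * sin B \<le> \<rho> powr e * sin A + \<rho> ^ q * sin B"
    using assms by (intro add_mono mult_right_mono powr_mono2 power_mono) auto
  with assms show False by linarith
qed

section \<open>The three changes of the equation\<close>

lemma powr_divide_power:
  fixes \<rho> :: real
  assumes "0 < \<rho>" and "0 < m"
  shows "(\<rho> powr (e / real m)) ^ m = \<rho> powr e"
  using assms by (simp add: powr_power)

lemma sin_add_eq_tcos:
  assumes "sin A \<noteq> 0"
  shows "sin (A + b) = X * sin b + tcos ((cos A - X) / sin A) b * sin A"
  using assms by (simp add: tcos_def sin_add field_simps)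

lemma tcos_at_minus:
  assumes "sin A \<noteq> 0"
  shows "tcos ((cos A - X) / sin A) (- A) = X"
  using assms by (simp add: tcos_def field_simps)

text \<open>The parameter of the shifted cosine depends only on \<open>A\<close> and
  \<open>X\<close>, so it stays fixed while \<open>b\<close> and \<open>Y\<close> change.\<close>

lemma trinomial_less_iff:
  assumes "0 < sin A"
  shows "Y * sin A + X * sin b < sin (A + b) \<longleftrightarrow> Y < tcos ((cos A - X) / sin A) b"
    and "Y * sin A + X * sin b \<le> sin (A + b) \<longleftrightarrow> Y \<le> tcos ((cos A - X) / sin A) b"
  using assms sin_add_eq_tcos[of A b X] by simp_all

text \<open>The weak inequality in the hypothesis allows an application after
  \<open>trinomial_mediant_lower\<close> as well as to a root.\<close>

lemma trinomial_Suc: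
  assumes "0 < A" and "0 < \<beta>" and "1 \<le> m" and "A + \<beta> / real m < pi" and "0 < \<rho>"
    and "\<rho> powr (e / real m) * sin A + \<rho> ^ q * sin (\<beta> / real m) \<le> sin (A + \<beta> / real m)"
  shows "\<rho> powr (e / real (Suc m)) * sin A + \<rho> ^ q * sin (\<beta> / real (Suc m))
    < sin (A + \<beta> / real (Suc m))"
proof -
  define T where "T = (cos A - \<rho> ^ q) / sin A"
  \<comment> \<open>The old and new right angles are the multiples \<open>Suc m\<close> and
    \<open>m\<close> of this common step, as \<open>tcos_power_less\<close> requires.\<close>
  define h where "h = \<beta> / (real m * real (Suc m))"
  have "0 < \<beta> / real m" using assms by simp
  then have "A < pi" "\<beta> / real m < pi" using assms by linarith+
  then have sA: "0 < sin A" using assms by (simp add: sin_gt_zero)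
  have h: "0 < h" "\<beta> / real m = real (Suc m) * h" "\<beta> / real (Suc m) = real m * h"
    using assms by (simp_all add: h_def)
  have le: "\<rho> powr (e / real m) \<le> tcos T (real (Suc m) * h)"
    using trinomial_less_iff(2)[OF sA] assms(6) unfolding T_def h by blast
  then have pos: "0 < tcos T (real (Suc m) * h)"
    using assms(5) by (intro less_le_trans[OF _ le]) auto
  have mh: "0 < real m * h" using h assms by simp
  have "(\<rho> powr (e / real (Suc m))) ^ Suc m = (\<rho> powr (e / real m)) ^ m"
    using assms powr_divide_power[of \<rho> "Suc m" e] powr_divide_power[of \<rho> m e] by simp
  also have "\<dots> \<le> tcos T (real (Suc m) * h) ^ m" using le by (intro power_mono) auto
  also have "\<dots> < tcos T (real m * h) ^ Suc m"
    using assms h pos \<open>\<beta> / real m < pi\<close> by (intro tcos_power_less) auto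
  finally have "\<rho> powr (e / real (Suc m)) < tcos T (real m * h)"
  proof (rule power_less_imp_less_base)
    show "0 \<le> tcos T (real m * h)"
      using pos h mh \<open>\<beta> / real m < pi\<close> tcos_pos[of T "real (Suc m) * h" "real m * h"]
      by (simp add: algebra_simps)
  qed
  then show ?thesis using trinomial_less_iff(1)[OF sA] unfolding T_def h by blast
qed

text \<open>The right angle drops by \<open>h = A / m\<close>. Log-concavity gives \<phi> (B - h) >
  \<phi> (- h) * \<phi> B, and \<phi> (- h) is at least the \<open>m\<close>-th root of \<phi> (-
  A), which is the new factor \<open>\<rho> powr (q / m)\<close>.\<close>

lemma trinomial_mediant_lower:
  assumes "0 < A" and "A < \<beta>" and "1 \<le> m" and "A + \<beta> / real m < pi" and "0 < \<rho>"
    and "\<rho> powr (e / real m) * sin A + \<rho> ^ q * sin (\<beta> / real m) \<le> sin (A + \<beta> / real m)"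
  shows "\<rho> powr ((real q + e) / real m) * sin A + \<rho> ^ q * sin ((\<beta> - A) / real m)
    < sin (A + (\<beta> - A) / real m)"
proof -
  define T where "T = (cos A - \<rho> ^ q) / sin A"
  define B h where "B = \<beta> / real m" and "h = A / real m"
  have h: "0 < h" "h \<le> A" "h < B" "real m * h = A"
    using assms by (auto simp: h_def B_def divide_strict_right_mono field_simps)
  have sA: "0 < sin A" "A < pi" "B < pi" using assms h by (auto simp: B_def intro: sin_gt_zero)
  have le: "\<rho> powr (e / real m) \<le> tcos T B"
    using trinomial_less_iff(2)[OF sA(1)] assms(6) unfolding T_def B_def by blast
  \<comment> \<open>Changing the sign of \<open>T\<close> reflects \<phi>, so the lemmas for
    nonnegative arguments apply on [- A, 0].\<close>
  have X: "tcos (- T) A = \<rho> ^ q"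
    using tcos_at_minus[of A "\<rho> ^ q"] sA by (simp add: T_def tcos_minus)
  have pos: "0 < tcos (- T) h"
    using X assms(5) h sA tcos_pos[of "- T" A h] by simp
  have "(\<rho> powr (real q / real m)) ^ m = \<rho> ^ q"
    using assms by (simp add: powr_divide_power powr_realpow)
  also have "\<dots> \<le> tcos (- T) h ^ m"
    using tcos_mult_le_power[of h m "- T"] h pos sA X by simp
  finally have q: "\<rho> powr (real q / real m) \<le> tcos (- T) h"
    using pos assms(3) power_le_imp_le_base[of _ "m - 1"] by (simp add: Suc_diff_le)
  have "\<rho> powr ((real q + e) / real m) = \<rho> powr (real q / real m) * \<rho> powr (e / real m)"
    by (simp add: powr_add[symmetric] add_divide_distrib)
  also have "\<dots> \<le> tcos (- T) h * tcos T B" using q le pos by (intro mult_mono) auto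
  also have "\<dots> < tcos T (B - h)"
  proof -
    have "0 < sin B" "0 < sin h" using h sA by (auto intro: sin_gt_zero)
    then have "0 < (1 + T\<^sup>2) * sin B * sin h" by (simp add: add_pos_nonneg)
    then show ?thesis using tcos_add[of T B "- h"] by (simp add: tcos_minus mult.commute)
  qed
  also have "B - h = (\<beta> - A) / real m" by (simp add: B_def h_def diff_divide_distrib)
  finally show ?thesis using trinomial_less_iff(1)[OF sA(1)] unfolding T_def by blast
qed

text \<open>By interpolation the left side is \<open>\<rho> ^ s * sin A\<close> times \<phi> (-
  \<beta>). Here \<open>\<rho> ^ s\<close> is at most the \<open>m\<close>-th power of \<phi> B,
  \<phi> (- \<beta>) at most that of \<phi> (- B), and \<phi> B * \<phi> (- B) < 1.\<close>

lemma trinomial_mediant_upper: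
  assumes "0 < \<beta>" and "\<beta> < A" and "1 \<le> m" and "A + \<beta> / real m < pi" and "0 < \<rho>"
    and "\<rho> powr (real s / real m) * sin A + \<rho> ^ q * sin (\<beta> / real m) \<le> sin (A + \<beta> / real m)"
  shows "\<rho> powr real (q + s) * sin \<beta> + \<rho> ^ s * sin (A - \<beta>) < sin A"
proof -
  define T where "T = (cos A - \<rho> ^ q) / sin A"
  define B where "B = \<beta> / real m"
  have B: "0 < B" "B \<le> \<beta>" "real m * B = \<beta>"
    using assms by (auto simp: B_def field_simps)
  have sA: "0 < sin A" "A < pi" using assms B by (auto simp: B_def intro!: sin_gt_zero)
  have le: "\<rho> powr (real s / real m) \<le> tcos T B"
    using trinomial_less_iff(2)[OF sA(1)] assms(6) unfolding T_def B_def by blast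
  have X: "tcos (- T) A = \<rho> ^ q"
    using tcos_at_minus[of A "\<rho> ^ q"] sA by (simp add: T_def tcos_minus)
  have pos: "0 < tcos (- T) B" "0 < tcos (- T) \<beta>"
    using X assms(1,2,5) B sA tcos_pos[of "- T" A B] tcos_pos[of "- T" A \<beta>] by simp_all
  have "0 < sin B" using B sA assms by (intro sin_gt_zero) auto
  then have "0 < (1 + T\<^sup>2) * sin B * sin B" by (simp add: add_pos_nonneg)
  then have less: "tcos T B * tcos (- T) B < 1"
    using tcos_add[of T B "- B"] by (simp add: tcos_minus)
  have "\<rho> ^ s = (\<rho> powr (real s / real m)) ^ m"
    using assms by (simp add: powr_divide_power powr_realpow)
  also have "\<dots> \<le> tcos T B ^ m" using le by (intro power_mono) auto
  finally have s: "\<rho> ^ s \<le> tcos T B ^ m" .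
  have posB: "0 < tcos T B"
    using assms(5) by (intro less_le_trans[OF _ le]) auto
  have "\<rho> ^ s * tcos (- T) \<beta> \<le> tcos T B ^ m * tcos (- T) B ^ m"
    using s tcos_mult_le_power[of B m "- T"] B pos posB assms sA by (intro mult_mono) auto
  also have "\<dots> = (tcos T B * tcos (- T) B) ^ m" by (simp add: power_mult_distrib)
  also have "\<dots> < 1" using less posB pos assms(3) by (simp add: power_less_one_iff)
  finally have "\<rho> ^ s * tcos (- T) \<beta> * sin A < sin A" using sA by simp
  moreover have "\<rho> powr real (q + s) * sin \<beta> + \<rho> ^ s * sin (A - \<beta>)
      = \<rho> ^ s * (tcos (- T) \<beta> * sin A)"
    using assms(5) tcos_interpolate[of "- T" \<beta> A] X
    by (simp add: powr_realpow power_add algebra_simps del: of_nat_add)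
  ultimately show ?thesis by (simp add: mult.assoc)
qed

section \<open>The root attached to a Farey interval\<close>

definition left_angle :: "rat \<Rightarrow> real \<Rightarrow> real" where
  "left_angle u y = 2 * pi * real (den u) * (y - of_rat u)"

text \<open>This is \<open>m * B\<close>; without the division by \<open>m\<close> the angles at a
  mediant are plain differences of the old ones.\<close>

definition right_angle :: "rat \<Rightarrow> real \<Rightarrow> real" where
  "right_angle v y = 2 * pi * real (den v) * (of_rat v - y)"

definition farey_root :: "nat \<Rightarrow> rat \<Rightarrow> rat \<Rightarrow> real \<Rightarrow> real" where
  "farey_root k u v y =
    (let q = den u; m = k div q; A = left_angle u y; B = right_angle v y / real m
     in THE \<rho>. 0 < \<rho> \<and> \<rho> < 1 \<and>
          \<rho> powr (real (den v) / real m) * sin A + \<rho> ^ q * sin B = sin (A + B))"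

text \<open>The pair \<open>u\<close>, \<open>v\<close> is not confined to \<open>[0, 1/2]\<close>: the reflection \<open>x \<mapsto> 1 - x\<close> in the definition of \<open>K\<close>
  is absorbed by allowing \<open>y\<close> to be either \<open>x\<close> or \<open>1 - x\<close>.\<close>

definition farey_cell :: "nat \<Rightarrow> rat \<Rightarrow> rat \<Rightarrow> real \<Rightarrow> bool" where
  "farey_cell k u v y \<longleftrightarrow> consecutive_in (farey k) u v \<and> den u < den v
     \<and> of_rat u < y \<and> y < of_rat v"

section \<open>Reduction of \<open>K\<close> to the root in a cell\<close>

lemma half_in_farey: "2 \<le> k \<Longrightarrow> 1 / 2 \<in> farey k"
  using den_le[of 2 "1 / 2" 1] by (simp add: farey_def)

text \<open>Since 1/2 is a Farey fraction, no neighbours straddle it. So neighbours may be taken in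
  all of \<open>farey k\<close>, where reflection acts.\<close>

lemma consecutive_in_lower_half:
  fixes x :: real
  assumes "2 \<le> k" and "x \<le> 1 / 2" and fg: "consecutive_in (farey k) f g"
    and x: "of_rat f < x" "x < of_rat g"
  shows "consecutive_in (farey k \<inter> {0..1/2}) f g"
proof -
  have half: "of_rat (1 / 2) = (1 / 2 :: real)" by (simp add: of_rat_divide)
  have "of_rat f < (of_rat (1 / 2) :: real)" using x assms(2) half by linarith
  then have "f < 1 / 2" by (simp only: of_rat_less)
  then have "g \<le> 1 / 2"
    using fg half_in_farey[OF assms(1)] by (force simp: consecutive_in_def)
  then show ?thesis
    using fg \<open>f < 1 / 2\<close> by (auto simp: consecutive_in_def farey_def)
qed

lemma K_eq_farey_root:
  assumes "2 \<le> k" and "\<theta> \<le> pi" and x: "x = \<theta> / (2 * pi)"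
    and cell: "farey_cell k u v y" and y: "y = x \<or> y = 1 - x"
  shows "K k \<theta> = farey_root k u v y"
proof -
  have half: "x \<le> 1 / 2" using assms(2) by (simp add: x field_simps)
  define f g where "f = (if y = x then u else 1 - v)" and "g = (if y = x then v else 1 - u)"
  have fg: "consecutive_in (farey k) f g" "of_rat f < x" "x < of_rat g"
    using cell y by (auto simp: f_def g_def farey_cell_def of_rat_diff consecutive_in_farey_reflect)
  have notin: "x \<notin> real_of_rat ` farey k" using consecutive_in_not_between[OF fg] .
  have fg': "consecutive_in (farey k \<inter> {0..1/2}) f g"
    using consecutive_in_lower_half[OF assms(1) half fg] .
  have the: "(THE (f, g). consecutive_in (farey k \<inter> {0..1/2}) f g
      \<and> real_of_rat f < x \<and> x < real_of_rat g) = (f, g)"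
  proof (rule the_equality)
    fix p
    assume "case p of (f, g) \<Rightarrow> consecutive_in (farey k \<inter> {0..1/2}) f g
      \<and> real_of_rat f < x \<and> x < real_of_rat g"
    then show "p = (f, g)"
      using consecutive_in_unique[OF fg' fg(2,3), of "fst p" "snd p"] by (cases p) simp
  qed (use fg' fg(2,3) in simp)
  \<comment> \<open>In the reflected case \<open>den f\<close> is \<open>den v\<close>, the larger
    one, so the conditional reflects back.\<close>
  have sel: "(if den f < den g then (f, g, x) else (1 - g, 1 - f, 1 - x)) = (u, v, y)"
    using cell y by (auto simp: f_def g_def farey_cell_def)
  show ?thesis
    unfolding K_def x[symmetric] Let_def the
    using notin by (simp only: if_False prod.case sel)
      (simp add: farey_root_def left_angle_def right_angle_def Let_def)
qed

text \<open>With \<open>a\<close> and \<open>b\<close> the two angles divided by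
  \<open>2 * pi\<close>, unimodularity reads \<open>s * a + m * q * b = 1\<close>. Both weights are
  at least 3, so \<open>a + b\<close> is below 1/2.\<close>

lemma farey_cell_angles:
  assumes "4 \<le> k" and cell: "farey_cell k u v y"
  shows "1 \<le> k div den u" and "0 < left_angle u y" and "0 < right_angle v y"
    and "left_angle u y + right_angle v y / real (k div den u) < pi"
proof -
  let ?q = "den u" and ?s = "den v"
  let ?m = "k div ?q"
  have uv: "consecutive_in (farey k) u v" "?q < ?s" "of_rat u < y" "y < of_rat v"
    using cell by (auto simp: farey_cell_def)
  have qk: "?q \<le> k" using uv(1) by (simp add: consecutive_in_def farey_def)
  then show m: "1 \<le> ?m" using den_pos[of u] by (simp add: div_greater_zero_iff Suc_le_eq)
  show "0 < left_angle u y" "0 < right_angle v y"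
    using uv den_pos by (simp_all add: left_angle_def right_angle_def)
  have uni: "(v - u) * of_nat ?q * of_nat ?s = 1" and big: "k < ?q + ?s"
    using consecutive_in_farey_unimodular[OF uv(1)] by auto
  define a b where "a = real ?q * (y - of_rat u)" and "b = real ?s * (of_rat v - y) / real ?m"
  have "0 \<le> a" "0 \<le> b" using uv by (simp_all add: a_def b_def)
  have "real_of_rat ((v - u) * of_nat ?q * of_nat ?s) = 1" unfolding uni by simp
  then have "(real_of_rat v - real_of_rat u) * real ?q * real ?s = 1"
    by (simp add: of_rat_mult of_rat_diff)
  moreover have "real ?m * b = real ?s * (of_rat v - y)" using m by (simp add: b_def)
  then have "real (?m * ?q) * b = real ?q * (real ?s * (of_rat v - y))" by simp
  ultimately have one: "real ?s * a + real (?m * ?q) * b = 1"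
    by (simp add: a_def algebra_simps)
  have "3 \<le> ?s" using uv(2) big assms(1) by linarith
  \<comment> \<open>For \<open>q \<le> 2\<close> the remainder takes at most 1 from
    \<open>k \<ge> 4\<close>; otherwise \<open>q\<close> alone suffices.\<close>
  moreover have "3 \<le> ?m * ?q"
  proof (cases "?q \<le> 2")
    case True
    have "k mod ?q < ?q" using den_pos by simp
    moreover have "?m * ?q + k mod ?q = k" by simp
    ultimately show ?thesis using True assms(1) by linarith
  next
    case False
    have "1 * ?q \<le> ?m * ?q" using m by (rule mult_right_mono) simp
    then show ?thesis using False by linarith
  qed
  ultimately have "3 * a + 3 * b \<le> real ?s * a + real (?m * ?q) * b"
    using \<open>0 \<le> a\<close> \<open>0 \<le> b\<close> by (intro add_mono mult_right_mono) linarith+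
  then have "a + b < 1 / 2" using one by linarith
  then have "2 * pi * (a + b) < 2 * pi * (1 / 2)" by (intro mult_strict_left_mono) auto
  then show "left_angle u y + right_angle v y / real ?m < pi"
    by (simp add: left_angle_def right_angle_def a_def b_def algebra_simps)
qed

lemma farey_root_solves:
  fixes u v :: rat and y :: real and k :: nat
  defines "q \<equiv> den u" and "m \<equiv> k div den u"
  defines "A \<equiv> left_angle u y" and "B \<equiv> right_angle v y / real (k div den u)"
  defines "e \<equiv> real (den v) / real (k div den u)" and "\<rho> \<equiv> farey_root k u v y"
  assumes "4 \<le> k" and cell: "farey_cell k u v y"
  shows "0 < \<rho>" and "\<rho> < 1" and "\<rho> powr e * sin A + \<rho> ^ q * sin B = sin (A + B)"
    and "\<And>\<sigma>. 0 < \<sigma> \<Longrightarrow> \<sigma> powr e * sin A + \<sigma> ^ q * sin B < sin (A + B) \<Longrightarrow> \<sigma> < \<rho>"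
proof -
  note ang = farey_cell_angles[OF assms(7) cell]
  have pos: "0 < A" "0 < B" "A + B < pi" "0 < e" "0 < q"
    using ang den_pos by (auto simp: A_def B_def e_def q_def)
  have "\<exists>!\<rho>. 0 < \<rho> \<and> \<rho> < 1 \<and> \<rho> powr e * sin A + \<rho> ^ q * sin B = sin (A + B)"
    using trinomial_root_ex1[OF pos] .
  from theI'[OF this]
  have sol: "0 < \<rho> \<and> \<rho> < 1 \<and> \<rho> powr e * sin A + \<rho> ^ q * sin B = sin (A + B)"
    by (simp add: \<rho>_def farey_root_def Let_def A_def B_def e_def q_def)
  then show "0 < \<rho>" "\<rho> < 1" "\<rho> powr e * sin A + \<rho> ^ q * sin B = sin (A + B)" by auto
  show "\<sigma> < \<rho>" if "0 < \<sigma>" "\<sigma> powr e * sin A + \<sigma> ^ q * sin B < sin (A + B)" for \<sigma>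
    using trinomial_root_greater[OF pos(1-4) _ _ that] sol by blast
qed

section \<open>Strict growth of the root in each case\<close>

lemma farey_root_less_same:
  assumes "5 \<le> n" and cell: "farey_cell (n - 1) u v y" and cell': "farey_cell n u v y"
    and "(n - 1) div den u \<noteq> n div den u"
  shows "farey_root (n - 1) u v y < farey_root n u v y"
proof -
  have k: "4 \<le> n - 1" "4 \<le> n" using assms(1) by auto
  have "n div den u = Suc ((n - 1) div den u)"
    using assms(1,4) div_Suc[of "n - 1" "den u"] by (auto split: if_splits)
  then show ?thesis
    using farey_root_solves(1,3)[OF k(1) cell] farey_cell_angles[OF k(1) cell]
    by (intro farey_root_solves(4)[OF k(2) cell'])
       (simp_all only:, intro trinomial_Suc, simp_all)
qed

text \<open>Equality of the two unit determinants shows that numerators add too, and the angles are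
  linear in numerator and denominator.\<close>

lemma angles_at_mediant:
  assumes uw: "consecutive_in (farey n) u w" and wv: "consecutive_in (farey n) w v"
    and "den w = den u + den v"
  shows "right_angle w y = right_angle v y - left_angle u y"
    and "left_angle w y = left_angle u y - right_angle v y"
proof -
  let ?q = "of_nat (den u) :: rat" and ?s = "of_nat (den v) :: rat" and ?n = "of_nat (den w) :: rat"
  have "(w - u) * ?q * ?n = (v - w) * ?n * ?s"
    using consecutive_in_farey_unimodular(1)[OF uw] consecutive_in_farey_unimodular(1)[OF wv]
    by simp
  then have "(w - u) * ?q = (v - w) * ?s" using den_pos[of w] by simp
  then have "?n * w = ?q * u + ?s * v" using assms(3) by (simp add: algebra_simps)
  then have "real_of_rat (?n * w) = real_of_rat (?q * u + ?s * v)" by simp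
  then have "real (den w) * of_rat w = real (den u) * of_rat u + real (den v) * of_rat v"
    by (simp only: of_rat_mult of_rat_add of_rat_of_nat_eq)
  then have "real (den w) * (of_rat w - y)
      = real (den v) * (of_rat v - y) - real (den u) * (y - of_rat u)"
    using assms(3) by (simp add: algebra_simps)
  from arg_cong[OF this, of "\<lambda>z. 2 * pi * z"]
  show "right_angle w y = right_angle v y - left_angle u y"
    "left_angle w y = left_angle u y - right_angle v y"
    by (simp_all add: right_angle_def left_angle_def algebra_simps)
qed

lemma farey_root_less_lower:
  assumes "5 \<le> n" and cell: "farey_cell (n - 1) u v y" and cell': "farey_cell n u w y"
    and wv: "consecutive_in (farey n) w v" and w: "den w = den u + den v"
  shows "farey_root (n - 1) u v y < farey_root n u w y"
proof -
  have k: "4 \<le> n - 1" "4 \<le> n" using assms(1) by auto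
  define m A \<beta> \<rho> where "m = (n - 1) div den u" and "A = left_angle u y"
    and "\<beta> = right_angle v y" and "\<rho> = farey_root (n - 1) u v y"
  note sol = farey_root_solves(1,3)[OF k(1) cell, folded m_def A_def \<beta>_def \<rho>_def]
  note ang = farey_cell_angles[OF k(1) cell, folded m_def A_def \<beta>_def \<rho>_def]
  have "right_angle w y = \<beta> - A"
    using angles_at_mediant(1)[OF _ wv w] cell' by (simp add: farey_cell_def A_def \<beta>_def)
  moreover have "0 < right_angle w y" using farey_cell_angles(3)[OF k(2) cell'] .
  ultimately have \<beta>: "right_angle w y = \<beta> - A" "A < \<beta>" by auto
  have step: "\<rho> powr ((real (den u) + real (den v)) / real m) * sin A
      + \<rho> ^ den u * sin ((\<beta> - A) / real m) < sin (A + (\<beta> - A) / real m)"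
    using \<beta> ang sol by (intro trinomial_mediant_lower) auto
  \<comment> \<open>The quotient can grow together with the insertion of the mediant, for instance
    when \<open>den u = 1\<close>. Then the mediant is inserted with \<open>m\<close> kept, and
    \<open>trinomial_Suc\<close> follows.\<close>
  have "n div den u = m \<or> n div den u = Suc m"
    using assms(1) div_Suc[of "n - 1" "den u"] by (auto simp: m_def split: if_splits)
  then have "\<rho> powr ((real (den u) + real (den v)) / real (n div den u)) * sin A
      + \<rho> ^ den u * sin ((\<beta> - A) / real (n div den u)) < sin (A + (\<beta> - A) / real (n div den u))"
  proof
    assume "n div den u = Suc m"
    moreover have "(\<beta> - A) / real m \<le> \<beta> / real m" using ang by (simp add: divide_right_mono)
    ultimately show ?thesis
      using \<beta> ang sol step by (simp only:) (intro trinomial_Suc, simp_all)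
  qed (use step in simp)
  then show ?thesis
    using farey_root_solves(4)[OF k(2) cell', of \<rho>] sol(1) \<beta>(1) w
    by (simp add: A_def \<rho>_def)
qed

text \<open>Above the mediant the endpoint \<open>v\<close> has the smaller denominator, so the new
  cell is reflected. Its quotient is 1, as \<open>n = den u + den v < 2 * den v\<close>.\<close>

lemma farey_root_less_upper:
  assumes "5 \<le> n" and cell: "farey_cell (n - 1) u v y"
    and cell': "farey_cell n (1 - v) (1 - w) (1 - y)"
    and uw: "consecutive_in (farey n) u w" and w: "den w = den u + den v" "den w = n"
  shows "farey_root (n - 1) u v y < farey_root n (1 - v) (1 - w) (1 - y)"
proof -
  have k: "4 \<le> n - 1" "4 \<le> n" using assms(1) by auto
  define m A \<beta> \<rho> where "m = (n - 1) div den u" and "A = left_angle u y"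
    and "\<beta> = right_angle v y" and "\<rho> = farey_root (n - 1) u v y"
  note sol = farey_root_solves(1,3)[OF k(1) cell, folded m_def A_def \<beta>_def \<rho>_def]
  note ang = farey_cell_angles[OF k(1) cell, folded m_def A_def \<beta>_def \<rho>_def]
  have wv: "consecutive_in (farey n) w v"
    using cell' by (simp add: farey_cell_def consecutive_in_farey_reflect)
  have angles: "left_angle (1 - v) (1 - y) = \<beta>" "right_angle (1 - w) (1 - y) = A - \<beta>"
    using angles_at_mediant(2)[OF uw wv w(1), of y]
    by (simp_all add: left_angle_def right_angle_def of_rat_diff A_def \<beta>_def)
  have "0 < right_angle (1 - w) (1 - y)" using farey_cell_angles(3)[OF k(2) cell'] .
  then have "\<beta> < A" using angles by simp
  have "den u < den v" using cell by (simp add: farey_cell_def)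
  then have div: "n div den v = 1" using w den_pos[of u] by (intro div_nat_eqI) auto
  have "\<rho> powr real (den u + den v) * sin \<beta> + \<rho> ^ den v * sin (A - \<beta>) < sin A"
    using \<open>\<beta> < A\<close> ang sol by (intro trinomial_mediant_upper[where m = m]) auto
  then show ?thesis
    using farey_root_solves(4)[OF k(2) cell', of \<rho>] sol(1) w angles div
    by (simp add: \<rho>_def)
qed

section \<open>Assembly of the cases\<close>

lemma K_step:
  assumes n: "5 \<le> n" and \<theta>: "\<theta> \<le> pi" and x: "x = \<theta> / (2 * pi)"
    and cell: "farey_cell (n - 1) u v y" and y: "y = x \<or> y = 1 - x"
  defines "unchanged \<equiv> consecutive_in (farey n) u v \<and> (n - 1) div den u = n div den u"
  shows "if unchanged then K (n - 1) \<theta> = K n \<theta> else K (n - 1) \<theta> < K n \<theta>"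
proof -
  have K: "K k \<theta> = farey_root k u' v' y'"
    if "4 \<le> k" "farey_cell k u' v' y'" "y' = y \<or> y' = 1 - y" for k u' v' y'
    using that y by (intro K_eq_farey_root[OF _ \<theta> x]) auto
  have k: "4 \<le> n - 1" "4 \<le> n" using n by auto
  have old: "K (n - 1) \<theta> = farey_root (n - 1) u v y" using K[OF k(1) cell] by simp
  have uv: "consecutive_in (farey (n - 1)) u v" "den u < den v" "of_rat u < y" "y < of_rat v"
    using cell by (auto simp: farey_cell_def)
  show ?thesis
  proof (cases "consecutive_in (farey n) u v")
    case True
    then have cell': "farey_cell n u v y" using uv by (simp add: farey_cell_def)
    have new: "K n \<theta> = farey_root n u v y" using K[OF k(2) cell'] by simp
    \<comment> \<open>The order enters \<open>farey_root\<close> only through its quotient by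
      \<open>den u\<close>.\<close>
    have "farey_root (n - 1) u v y = farey_root n u v y" if "(n - 1) div den u = n div den u"
      using that by (simp add: farey_root_def Let_def del: One_nat_def)
    then show ?thesis
      using farey_root_less_same[OF n cell cell'] True
      by (auto simp: unchanged_def old new simp del: One_nat_def)
  next
    case False
    then obtain w where w: "consecutive_in (farey n) u w" "consecutive_in (farey n) w v"
        "den w = n" "n = den u + den v"
      using consecutive_in_farey_split[OF uv(1)] by blast
    have dw: "den u < den w" "den v < den w" "den w = den u + den v"
      using w den_pos[of u] den_pos[of v] by auto
    consider "y < of_rat w" | "y = of_rat w" | "of_rat w < y" by linarith
    then have "K (n - 1) \<theta> < K n \<theta>"
    proof cases
      case 1
      then have cell': "farey_cell n u w y" using w dw uv by (simp add: farey_cell_def)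
      show ?thesis
        using farey_root_less_lower[OF n cell cell' w(2) dw(3)] K[OF k(2) cell'] old by simp
    next
      case 2
      then have "x = of_rat w \<or> x = of_rat (1 - w)" using y by (auto simp: of_rat_diff)
      moreover have "w \<in> farey n" using w(1) by (simp add: consecutive_in_def)
      ultimately have "x \<in> real_of_rat ` farey n" by force
      \<comment> \<open>The point itself has become a Farey fraction, while the old root was below
        1.\<close>
      then have "K n \<theta> = 1" by (simp add: K_def x Let_def)
      then show ?thesis using farey_root_solves(2)[OF k(1) cell] old by simp
    next
      case 3
      then have cell': "farey_cell n (1 - v) (1 - w) (1 - y)"
        using w dw uv by (simp add: farey_cell_def of_rat_diff consecutive_in_farey_reflect)
      show ?thesis
        using farey_root_less_upper[OF n cell cell' w(1) dw(3) w(3)] K[OF k(2) cell'] old by simp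
    qed
    then show ?thesis using False by (simp add: unchanged_def)
  qed
qed

text \<open>A common denominator turns the unimodular relation into an integer times
  \<open>den f\<close> equal to 1. Then both denominators are 1, against
  \<open>k < den f + den g\<close>.\<close>

lemma consecutive_in_farey_den_neq:
  assumes "2 \<le> k" and "consecutive_in (farey k) f g"
  shows "den f \<noteq> den g"
proof
  assume eq: "den f = den g"
  note uni = consecutive_in_farey_unimodular[OF assms(2)]
  let ?z = "fst (quotient_of g) - fst (quotient_of f)"
  have "(g - f) * of_nat (den f) = of_int ?z"
    using den_mult[of g] den_mult[of f] eq by (simp add: algebra_simps)
  then have "of_int (?z * int (den f)) = (1 :: rat)"
    using uni(1) eq by simp
  then have "?z * int (den f) = 1" by (simp only: of_int_eq_1_iff)
  then have "int (den f) dvd 1" by (metis dvd_triv_right)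
  then have "den f = 1" by simp
  then show False using uni(2) eq assms(1) by simp
qed

theorem theorem6p4:
  fixes n :: nat and \<theta> x :: real
  assumes "n \<ge> 5" and "0 \<le> \<theta>" and "\<theta> \<le> pi" and "x = \<theta> / (2 * pi)"
  shows "K (n - 1) \<theta> \<le> K n \<theta>
    \<and> (x \<in> real_of_rat ` farey (n - 1) \<longrightarrow> K (n - 1) \<theta> = 1 \<and> K n \<theta> = 1)
    \<and> (x \<notin> real_of_rat ` farey (n - 1) \<longrightarrow>
        (\<exists>!(f, g). consecutive_in (farey (n - 1)) f g \<and> real_of_rat f < x \<and> x < real_of_rat g)
        \<and> (\<forall>f g q. consecutive_in (farey (n - 1)) f g \<and> real_of_rat f < x \<and> x < real_of_rat g
              \<and> q = min (den f) (den g) \<longrightarrow>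
            (K (n - 1) \<theta> = K n \<theta> \<longleftrightarrow>
              consecutive_in (farey n) f g \<and> (n - 1) div q = n div q)))"
proof (cases "x \<in> real_of_rat ` farey (n - 1)")
  case True
  moreover have "farey (n - 1) \<subseteq> farey n" by (auto simp: farey_def)
  ultimately have "K (n - 1) \<theta> = 1" "K n \<theta> = 1"
    using assms(4) by (auto simp: K_def Let_def)
  then show ?thesis using True by simp
next
  case False
  have ends: "0 \<in> farey (n - 1)" "1 / 2 \<in> farey (n - 1)"
    using den_le[of 1 0 0] half_in_farey[of "n - 1"] assms(1) by (auto simp: farey_def)
  have half: "of_rat (1 / 2) = (1 / 2 :: real)" by (simp add: of_rat_divide)
  have "0 \<le> x" "x \<le> 1 / 2" 
    unfolding assms(4) using assms(2,3) by (simp_all add: field_simps)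
  moreover have "x \<noteq> of_rat 0" "x \<noteq> of_rat (1 / 2)" using ends False by blast+
  ultimately have "of_rat 0 < x" "x < of_rat (1 / 2)" by (simp_all add: half)
  then obtain f g where fg: "consecutive_in (farey (n - 1)) f g" "of_rat f < x" "x < of_rat g"
    using consecutive_in_bracket[OF finite_farey ends _ _ False] by blast
  define unchanged where "unchanged \<longleftrightarrow> consecutive_in (farey n) f g
    \<and> (n - 1) div min (den f) (den g) = n div min (den f) (den g)"
  have step: "if unchanged then K (n - 1) \<theta> = K n \<theta> else K (n - 1) \<theta> < K n \<theta>"
  proof (cases "den f < den g")
    case True
    then have "farey_cell (n - 1) f g x" using fg by (simp add: farey_cell_def)
    from K_step[OF assms(1,3,4) this] show ?thesis using True by (simp add: unchanged_def)
  next
    case False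
    then have less: "den g < den f"
      using consecutive_in_farey_den_neq[OF _ fg(1)] assms(1) by linarith
    \<comment> \<open>Reflection moves the smaller denominator to the left.\<close>
    then have "farey_cell (n - 1) (1 - g) (1 - f) (1 - x)"
      using fg by (simp add: farey_cell_def of_rat_diff consecutive_in_farey_reflect)
    from K_step[OF assms(1,3,4) this] show ?thesis
      using less by (simp add: unchanged_def consecutive_in_farey_reflect)
  qed
  have "\<exists>!(f, g). consecutive_in (farey (n - 1)) f g \<and> real_of_rat f < x \<and> x < real_of_rat g"
  proof (rule ex1I[of _ "(f, g)"])
    fix p
    assume "case p of (f, g) \<Rightarrow> consecutive_in (farey (n - 1)) f g
      \<and> real_of_rat f < x \<and> x < real_of_rat g"
    then show "p = (f, g)"
      using consecutive_in_unique[OF fg, of "fst p" "snd p"] by (cases p) simp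
  qed (use fg in simp)
  moreover have "K (n - 1) \<theta> = K n \<theta> \<longleftrightarrow>
      consecutive_in (farey n) f' g' \<and> (n - 1) div q = n div q"
    if "consecutive_in (farey (n - 1)) f' g' \<and> real_of_rat f' < x \<and> x < real_of_rat g'
      \<and> q = min (den f') (den g')" for f' g' q
    using that consecutive_in_unique[OF fg, of f' g'] step
    by (auto simp: unchanged_def split: if_splits)
  moreover have "K (n - 1) \<theta> \<le> K n \<theta>" using step by (auto split: if_splits)
  ultimately show ?thesis using False by blast
qed

end
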